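(* Let $d \ge 2$, let $X, X_1, X_2, \ldots$ be i.i.d. random vectors in $\mathbb{R}^d$, and let $S_n = \sum_{i=1}^n X_i$ and $G_n = \frac1n \sum_{i=1}^n S_i$ for $n \ge 1$. Suppose that $\mathbb{E}[\|X\|^2] < \infty$, that $\mathbb{E} X = 0$, and that the matrix $M := \mathbb{E}[X X^\top]$ is positive-definite. Suppose also that the minimal subgroup associated with $X$ is $H\mathbb{Z}^d$ for some real $d\times d$ matrix $H$ with $|\det H| > 0$. Then $$\lim_{n\to\infty} \frac{\log \|G_n\|}{\log n} = \frac12, \quad \text{almost surely}.$$
   Context: Vectors are column vectors and $\|\cdot\|$ is the Euclidean norm. "The minimal subgroup associated with $X$ is $H\mathbb{Z}^d$" means: $\mathbb{P}(X \in b + H\mathbb{Z}^d) = 1$ for some $b \in \mathbb{R}^d$, and whenever $\mathbb{P}(X \in x + L') = 1$ for some $x \in \mathbb{R}^d$ and some closed subgroup $L'$ of $\mathbb{R}^d$, one has $H\mathbb{Z}^d \subseteq L'$. Convention: $\log 0 = -\infty$. *)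

theory Defs
  imports "HOL-Probability.Probability"
begin

(* The library has ln 0 = 0; here log 0 = -\<infinity>. Only applied to nonnegative reals. *)
definition elog :: "real \<Rightarrow> ereal" where
  "elog x = (if x = 0 then -\<infinity> else ereal (ln x))"

definition positive_definite :: "real^'n^'n \<Rightarrow> bool" where
  "positive_definite A \<longleftrightarrow> transpose A = A \<and> (\<forall>x. x \<noteq> 0 \<longrightarrow> 0 < x \<bullet> (A *v x))"

definition closed_subgroup :: "'b::real_normed_vector set \<Rightarrow> bool" where
  "closed_subgroup L \<longleftrightarrow>
     closed L \<and> 0 \<in> L \<and> (\<forall>x\<in>L. \<forall>y\<in>L. x + y \<in> L) \<and> (\<forall>x\<in>L. - x \<in> L)"

definition lattice_gen :: "real^'n^'n \<Rightarrow> (real^'n) set" where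
  "lattice_gen H = (\<lambda>z. H *v z) ` {z. \<forall>i. z $ i \<in> \<int>}"

(* L is the minimal subgroup associated with the random vector X. *)
definition is_minimal_subgroup ::
    "'a measure \<Rightarrow> ('a \<Rightarrow> real^'n) \<Rightarrow> (real^'n) set \<Rightarrow> bool" where
  "is_minimal_subgroup M X L \<longleftrightarrow>
     (\<exists>b. measure M {\<omega> \<in> space M. X \<omega> \<in> (+) b ` L} = 1) \<and>
     (\<forall>x L'. closed_subgroup L' \<longrightarrow>
        measure M {\<omega> \<in> space M. X \<omega> \<in> (+) x ` L'} = 1 \<longrightarrow> L \<subseteq> L')"

definition second_moment_matrix :: "'a measure \<Rightarrow> ('a \<Rightarrow> real^'n) \<Rightarrow> real^'n^'n" where
  "second_moment_matrix M X =
     (\<integral>\<omega>. (columnvector (X \<omega>) :: real^1^'n) ** (rowvector (X \<omega>) :: real^'n^1) \<partial>M)"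

(* X 0 is not a summand: the sums start at index 1. *)
definition walk :: "(nat \<Rightarrow> 'a \<Rightarrow> real^'n) \<Rightarrow> nat \<Rightarrow> 'a \<Rightarrow> real^'n" where
  "walk X n \<omega> = (\<Sum>i=1..n. X i \<omega>)"

definition center_of_mass :: "(nat \<Rightarrow> 'a \<Rightarrow> real^'n) \<Rightarrow> nat \<Rightarrow> 'a \<Rightarrow> real^'n" where
  "center_of_mass X n \<omega> = (1 / real n) *\<^sub>R (\<Sum>i=1..n. walk X i \<omega>)"

end

theory Submission
  imports Defs "HOL-Real_Asymp.Real_Asymp"
begin

text \<open>
  Write \<open>T n = n *\<^sub>R G n\<close> for the sum of the first \<open>n\<close> positions of the walk. It suffices to show that
  for every \<open>\<eta> > 0\<close>, almost surely \<open>n powr (3/2 - \<eta>) \<le> norm (T n) \<le> n powr (3/2 + \<eta>)\<close> for all large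
  \<open>n\<close>; for countably many \<open>\<eta>\<close> tending to \<open>0\<close> this can be done simultaneously.

  The upper bound only needs that the walk itself is at most \<open>n powr (1/2 + \<delta>)\<close>. The coordinates of the
  steps are orthogonal in \<open>L\<^sup>2\<close>, and dyadic chaining controls the maximum of their partial sums up to
  \<open>2 ^ m\<close> at the price of a factor polynomial in \<open>m\<close> (\<open>orthogonal_sums_growth\<close>).

  The lower bound is a small ball estimate followed by Borel--Cantelli along a sparse sequence.
  Since \<open>T n\<close> equals the sum of \<open>(n + 1 - j) *\<^sub>R X j\<close> over \<open>j \<le> n\<close>, its characteristic function is the
  product of the values \<open>\<phi> ((n + 1 - j) *\<^sub>R w)\<close>, where \<open>\<phi>\<close> belongs to one step. Only frequencies
  with \<open>n * norm w\<close> small matter, because the balls have radius much larger than \<open>n\<close>; there the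
  second-order expansion of \<open>\<phi>\<close> at the origin and positive definiteness give a Gaussian bound with
  variance of order \<open>n ^ 3\<close>. Smoothing the indicator of a ball by a Gaussian in two coordinates yields
  \<open>P (norm (T n) \<le> r) \<le> C * (r\<^sup>2 / n ^ 3 + n\<^sup>2 / r\<^sup>2)\<close> (\<open>walk_sum_small_ball\<close>).

  Fix \<open>b \<ge> 3\<close> and take the checkpoints \<open>n = k ^ b\<close> and the radius \<open>r = 2 * n powr (3/2 - 3/(4*b))\<close>. The
  small ball probability is then \<open>O(k powr (-3/2))\<close>, which is summable. It is here that two dimensions
  are needed: in one dimension the main term would be the square root of this, and the sum would diverge.
  Between two checkpoints \<open>T\<close> changes by at most the gap, of order \<open>k ^ (b - 1)\<close>, times the size of the
  walk, and this is of smaller order than \<open>r\<close> (\<open>partial_sums_lower_growth\<close>).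
\<close>

section \<open>The characteristic function of one step near the origin\<close>

text \<open>The quadratic form attains its minimum on the compact unit sphere, and is homogeneous.\<close>

lemma positive_definite_lower_bound:
  fixes A :: "real^'n^'n"
  assumes "positive_definite A"
  obtains l where "l > 0" "\<And>x. l * (norm x)\<^sup>2 \<le> x \<bullet> (A *v x)"
proof -
  have cont: "continuous_on (sphere 0 1) (\<lambda>x::real^'n. x \<bullet> (A *v x))"
    by (intro continuous_intros)
  have "sphere (0::real^'n) 1 \<noteq> {}" by simp
  from continuous_attains_inf[OF compact_sphere this cont]
  obtain u :: "real^'n" where u: "norm u = 1"
    and min: "\<And>y. norm y = 1 \<Longrightarrow> u \<bullet> (A *v u) \<le> y \<bullet> (A *v y)"
    by auto
  show thesis
  proof
    show "u \<bullet> (A *v u) > 0"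
    proof -
      have "u \<noteq> 0" using u by auto
      then show ?thesis using assms unfolding positive_definite_def by blast
    qed
    show "u \<bullet> (A *v u) * (norm x)\<^sup>2 \<le> x \<bullet> (A *v x)" for x
    proof (cases "x = 0")
      case False
      define y where "y = (1 / norm x) *\<^sub>R x"
      have x: "x = norm x *\<^sub>R y" and y: "norm y = 1"
        using False by (auto simp: y_def)
      have "x \<bullet> (A *v x) = (norm x)\<^sup>2 * (y \<bullet> (A *v y))"
        by (subst (1 2) x) (simp add: matrix_vector_mult_scaleR power2_eq_square)
      then show ?thesis
        using min[OF y] by (simp add: mult.commute mult_right_mono)
    qed simp
  qed
qed

lemma inner_second_moment_matrix:
  fixes X :: "'a \<Rightarrow> real^'n"
  assumes [measurable]: "X \<in> borel_measurable M"
    and int: "integrable M (\<lambda>\<omega>. (norm (X \<omega>))\<^sup>2)"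
  shows "w \<bullet> (second_moment_matrix M X *v w) = (\<integral>\<omega>. (w \<bullet> X \<omega>)\<^sup>2 \<partial>M)"
proof -
  let ?Y = "\<lambda>\<omega>. (columnvector (X \<omega>) :: real^1^'n) ** (rowvector (X \<omega>) :: real^'n^1)"
  have comp: "?Y \<omega> $ i $ j = X \<omega> $ i * X \<omega> $ j" for \<omega> i j
    by (simp add: matrix_matrix_mult_def columnvector_def rowvector_def)
  have Y: "?Y \<omega> = (\<Sum>i\<in>UNIV. \<Sum>j\<in>UNIV. (X \<omega> $ i * X \<omega> $ j) *\<^sub>R axis i (axis j 1))" for \<omega>
  proof -
    have "(\<Sum>j'\<in>UNIV. (X \<omega> $ i' * X \<omega> $ j') * axis i' (axis j' 1) $ i $ j)
        = (if i' = i then X \<omega> $ i * X \<omega> $ j else 0)" for i i' j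
      by (cases "i' = i") (simp_all add: axis_def if_distrib cong: if_cong)
    then show ?thesis unfolding vec_eq_iff comp by simp
  qed
  have [measurable]: "(\<lambda>\<omega>. X \<omega> $ i) \<in> borel_measurable M" for i
    by (subst cart_eq_inner_axis) measurable
  have intc: "integrable M (\<lambda>\<omega>. X \<omega> $ i * X \<omega> $ j)" for i j
  proof (rule Bochner_Integration.integrable_bound[OF int])
    show "AE \<omega> in M. norm (X \<omega> $ i * X \<omega> $ j) \<le> norm ((norm (X \<omega>))\<^sup>2)"
      by (auto simp: norm_mult power2_eq_square abs_mult intro!: mult_mono component_le_norm_cart)
  qed measurable
  have "integrable M ?Y"
    unfolding Y by (intro Bochner_Integration.integrable_sum integrable_scaleR_left intc)
  moreover have "bounded_linear (\<lambda>A::real^'n^'n. w \<bullet> (A *v w))"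
    unfolding linear_conv_bounded_linear[symmetric] linear_iff
    by (simp add: matrix_vector_mult_add_rdistrib inner_add_right scaleR_matrix_vector_assoc[symmetric])
  ultimately have "w \<bullet> (second_moment_matrix M X *v w) = (\<integral>\<omega>. w \<bullet> (?Y \<omega> *v w) \<partial>M)"
    unfolding second_moment_matrix_def by (rule integral_bounded_linear[symmetric, rotated])
  also have "(\<lambda>\<omega>. w \<bullet> (?Y \<omega> *v w)) = (\<lambda>\<omega>. (w \<bullet> X \<omega>)\<^sup>2)"
  proof
    fix \<omega>
    show "w \<bullet> (?Y \<omega> *v w) = (w \<bullet> X \<omega>)\<^sup>2"
      by (simp add: inner_vec_def matrix_vector_mult_def comp power2_eq_square sum_distrib_left
          sum_distrib_right mult_ac)
  qed
  finally show ?thesis .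
qed

text \<open>
  The constants \<open>c\<close> and \<open>\<kappa>\<close> hold for all directions of \<open>w\<close> at once, which is why the expansion is made
  for the projections \<open>w \<bullet> X\<close> at the fixed frequency \<open>1\<close> instead of along one line.
\<close>

lemma (in prob_space) char_gaussian_decay:
  fixes X :: "'a \<Rightarrow> 'b::euclidean_space"
  assumes [measurable]: "X \<in> borel_measurable M"
    and int: "integrable M (\<lambda>\<omega>. (norm (X \<omega>))\<^sup>2)"
    and mean: "expectation X = 0"
    and "l > 0" and nondeg: "\<And>w. l * (norm w)\<^sup>2 \<le> expectation (\<lambda>\<omega>. (w \<bullet> X \<omega>)\<^sup>2)"
  obtains c \<kappa> where "c > 0" "\<kappa> > 0"
    "\<And>w. norm w \<le> \<kappa> \<Longrightarrow>
       cmod (char (distr M borel (\<lambda>\<omega>. w \<bullet> X \<omega>)) 1) \<le> exp (- c * (norm w)\<^sup>2)"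
proof -
  \<comment> \<open>The remainder in the second-order expansion at \<open>w\<close> is at most \<open>(norm w)\<^sup>2\<close> times the mean of
      \<open>min (norm X)\<^sup>2 (norm w * (norm X) ^ 3)\<close>. Dominated convergence makes this mean small, uniformly
      in the direction of \<open>w\<close>, once \<open>norm w \<le> 1 / (N + 1)\<close>.\<close>
  define m where "m = (\<lambda>n \<omega>. min ((norm (X \<omega>))\<^sup>2) (1 / real (Suc n) * norm (X \<omega>) ^ 3))"
  have [measurable]: "m n \<in> borel_measurable M" for n
    unfolding m_def by measurable
  have m_bound: "norm (m n \<omega>) \<le> (norm (X \<omega>))\<^sup>2" for n \<omega>
    by (auto simp: m_def min_def)
  have m_int: "integrable M (m n)" for n
    by (rule Bochner_Integration.integrable_bound[OF int]) (use m_bound in auto)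
  have "(\<lambda>n. expectation (m n)) \<longlonglongrightarrow> expectation (\<lambda>_. 0)"
  proof (rule integral_dominated_convergence[OF _ _ int])
    show "AE \<omega> in M. (\<lambda>n. m n \<omega>) \<longlonglongrightarrow> 0"
    proof (rule AE_I2)
      fix \<omega>
      have "(\<lambda>n. 1 / real (Suc n) * norm (X \<omega>) ^ 3) \<longlonglongrightarrow> 0 * norm (X \<omega>) ^ 3"
        using lim_inverse_n' by (intro tendsto_mult tendsto_const LIMSEQ_Suc)
      then have "(\<lambda>n. m n \<omega>) \<longlonglongrightarrow> min ((norm (X \<omega>))\<^sup>2) (0 * norm (X \<omega>) ^ 3)"
        unfolding m_def by (intro tendsto_min tendsto_const)
      then show "(\<lambda>n. m n \<omega>) \<longlonglongrightarrow> 0" by simp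
    qed
  qed (use m_bound in auto)
  then have "eventually (\<lambda>n. expectation (m n) < l / 4) sequentially"
    using \<open>l > 0\<close> by (intro order_tendstoD) auto
  then obtain N where N: "expectation (m N) < l / 4"
    by (auto simp: eventually_sequentially)
  define B where "B = expectation (\<lambda>\<omega>. (norm (X \<omega>))\<^sup>2)"
  have "B \<ge> 0" unfolding B_def by simp
  \<comment> \<open>The second constraint ensures \<open>?V \<le> 2\<close> below, so that \<open>1 - ?V / 2\<close> is its own absolute value.\<close>
  define \<kappa> where "\<kappa> = min (1 / real (Suc N)) (1 / (1 + B))"
  have "\<kappa> > 0" and \<kappa>N: "\<kappa> \<le> 1 / real (Suc N)" and \<kappa>B: "\<kappa> \<le> 1 / (1 + B)" and \<kappa>1: "\<kappa> \<le> 1"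
    using \<open>B \<ge> 0\<close> by (simp_all add: \<kappa>_def min_le_iff_disj)
  have main: "cmod (char (distr M borel (\<lambda>\<omega>. w \<bullet> X \<omega>)) 1) \<le> exp (- (l / 4) * (norm w)\<^sup>2)"
    if w: "norm w \<le> \<kappa>" for w
  proof -
    let ?V = "expectation (\<lambda>\<omega>. (w \<bullet> X \<omega>)\<^sup>2)"
    have CS: "\<bar>w \<bullet> X \<omega>\<bar> \<le> norm w * norm (X \<omega>)" for \<omega>
      by (rule Cauchy_Schwarz_ineq2)
    have sq: "(w \<bullet> X \<omega>)\<^sup>2 \<le> (norm w)\<^sup>2 * (norm (X \<omega>))\<^sup>2" for \<omega>
      using power_mono[OF CS abs_ge_zero, of \<omega> 2] by (simp add: power_mult_distrib)
    have int2: "integrable M (\<lambda>\<omega>. (w \<bullet> X \<omega>)\<^sup>2)"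
      by (rule Bochner_Integration.integrable_bound[OF integrable_mult_right[OF int, of "(norm w)\<^sup>2"]])
         (use sq in auto)
    have "integrable M (\<lambda>\<omega>. norm (X \<omega>))"
      by (rule square_integrable_imp_integrable[OF _ int]) measurable
    then have intX: "integrable M X"
      by (simp add: integrable_norm_iff)
    have mean0: "expectation (\<lambda>\<omega>. w \<bullet> X \<omega>) = 0"
      using intX mean by simp
    have V_le: "?V \<le> 2"
    proof -
      have "?V \<le> expectation (\<lambda>\<omega>. (norm w)\<^sup>2 * (norm (X \<omega>))\<^sup>2)"
        by (intro integral_mono int2 integrable_mult_right int sq)
      also have "\<dots> = norm w * (norm w * B)"
        by (simp add: B_def power2_eq_square)
      finally have V: "?V \<le> norm w * (norm w * B)" .
      have "norm w * B \<le> 1"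
      proof -
        have "norm w * B \<le> (1 / (1 + B)) * B"
          using w \<kappa>B \<open>B \<ge> 0\<close> by (intro mult_right_mono) auto
        also have "\<dots> \<le> 1" using \<open>B \<ge> 0\<close> by (simp add: divide_simps)
        finally show ?thesis .
      qed
      then have "norm w * (norm w * B) \<le> 1 * 1"
        using w \<kappa>1 \<open>B \<ge> 0\<close> by (intro mult_mono) auto
      with V show ?thesis by simp
    qed
    have "cmod (char (distr M borel (\<lambda>\<omega>. w \<bullet> X \<omega>)) 1 - (1 - 1\<^sup>2 * ?V / 2))
        \<le> (1\<^sup>2 / 6) * expectation (\<lambda>\<omega>. min (6 * (w \<bullet> X \<omega>)\<^sup>2) (\<bar>1\<bar> * \<bar>w \<bullet> X \<omega>\<bar> ^ 3))"
      using int2 intX mean0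
      by (intro char_approx3') auto
    also have "\<dots> \<le> (1 / 6) * expectation (\<lambda>\<omega>. 6 * (norm w)\<^sup>2 * m N \<omega>)"
    proof -
      have le: "min (6 * (w \<bullet> X \<omega>)\<^sup>2) (\<bar>w \<bullet> X \<omega>\<bar> ^ 3) \<le> 6 * (norm w)\<^sup>2 * m N \<omega>" for \<omega>
      proof -
        have "\<bar>w \<bullet> X \<omega>\<bar> ^ 3 \<le> (norm w * norm (X \<omega>)) ^ 3"
          by (intro power_mono CS) auto
        also have "\<dots> = (norm w)\<^sup>2 * (norm w * norm (X \<omega>) ^ 3)"
          by (simp add: power_mult_distrib power2_eq_square power3_eq_cube)
        also have "\<dots> \<le> (norm w)\<^sup>2 * (1 / real (Suc N) * norm (X \<omega>) ^ 3)"
          using w \<kappa>N by (intro mult_left_mono mult_right_mono) auto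
        finally have cube: "\<bar>w \<bullet> X \<omega>\<bar> ^ 3 \<le> (norm w)\<^sup>2 * (1 / real (Suc N) * norm (X \<omega>) ^ 3)" .
        have "min (6 * (w \<bullet> X \<omega>)\<^sup>2) (\<bar>w \<bullet> X \<omega>\<bar> ^ 3) \<le> min (6 * (w \<bullet> X \<omega>)\<^sup>2) (6 * \<bar>w \<bullet> X \<omega>\<bar> ^ 3)"
          by (intro min.mono order.refl) simp
        also have "\<dots> = 6 * min ((w \<bullet> X \<omega>)\<^sup>2) (\<bar>w \<bullet> X \<omega>\<bar> ^ 3)"
          by (simp add: min_mult_distrib_left)
        also have "\<dots> \<le> 6 * min ((norm w)\<^sup>2 * (norm (X \<omega>))\<^sup>2) ((norm w)\<^sup>2 * (1 / real (Suc N) * norm (X \<omega>) ^ 3))"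
          using sq[of \<omega>] cube by (intro mult_left_mono min.mono) auto
        also have "\<dots> = 6 * (norm w)\<^sup>2 * m N \<omega>"
          by (simp add: m_def min_mult_distrib_left)
        finally show ?thesis .
      qed
      have "integrable M (\<lambda>\<omega>. min (6 * (w \<bullet> X \<omega>)\<^sup>2) (\<bar>w \<bullet> X \<omega>\<bar> ^ 3))"
        by (rule Bochner_Integration.integrable_bound[OF integrable_mult_right[OF int2, of 6]])
           (auto simp: min_def)
      then have "expectation (\<lambda>\<omega>. min (6 * (w \<bullet> X \<omega>)\<^sup>2) (\<bar>w \<bullet> X \<omega>\<bar> ^ 3))
          \<le> expectation (\<lambda>\<omega>. 6 * (norm w)\<^sup>2 * m N \<omega>)"
        by (intro integral_mono le integrable_mult_right m_int)
      then show ?thesis by simp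
    qed
    also have "\<dots> = (norm w)\<^sup>2 * expectation (m N)" by simp
    also have "\<dots> \<le> (norm w)\<^sup>2 * (l / 4)"
      using N by (intro mult_left_mono) auto
    finally have "cmod (char (distr M borel (\<lambda>\<omega>. w \<bullet> X \<omega>)) 1 - of_real (1 - ?V / 2))
        \<le> (norm w)\<^sup>2 * (l / 4)" by simp
    moreover have "cmod (of_real (1 - ?V / 2)) = 1 - ?V / 2"
      using V_le unfolding norm_of_real by simp
    ultimately have "cmod (char (distr M borel (\<lambda>\<omega>. w \<bullet> X \<omega>)) 1) \<le> 1 - ?V / 2 + (norm w)\<^sup>2 * (l / 4)"
      using norm_triangle_sub[of "char (distr M borel (\<lambda>\<omega>. w \<bullet> X \<omega>)) 1" "of_real (1 - ?V / 2)"]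
      by linarith
    also have "\<dots> \<le> 1 + (- (l / 4) * (norm w)\<^sup>2)"
      using nondeg[of w] by (simp add: algebra_simps)
    also have "\<dots> \<le> exp (- (l / 4) * (norm w)\<^sup>2)" by (rule exp_ge_add_one_self)
    finally show ?thesis .
  qed
  show thesis by (rule that[OF _ \<open>\<kappa> > 0\<close> main]) (use \<open>l > 0\<close> in simp)
qed

section \<open>Small ball probabilities from characteristic functions\<close>

text \<open>Times the standard normal density, the integrand is up to a constant a centred normal density
  of variance \<open>1 / (1 + 2 * a)\<close>.\<close>

lemma std_normal_integral_exp_square:
  assumes "a \<ge> 0"
  shows "(\<integral>s. exp (- (a * s\<^sup>2)) \<partial>std_normal_distribution) = 1 / sqrt (1 + 2 * a)"
proof -
  define q where "q = 1 / sqrt (1 + 2 * a)"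
  have "q > 0" using assms by (simp add: q_def)
  have q2: "q\<^sup>2 = 1 / (1 + 2 * a)"
    using assms by (simp add: q_def power_divide)
  have "std_normal_density s * exp (- (a * s\<^sup>2)) = q * normal_density 0 q s" for s
  proof -
    have "std_normal_density s * exp (- (a * s\<^sup>2)) = 1 / sqrt (2 * pi) * exp (- (s\<^sup>2 / (2 * q\<^sup>2)))"
      using assms by (simp add: std_normal_density_def q2 mult_exp_exp[symmetric] field_simps
          exp_add[symmetric] flip: exp_minus)
    also have "\<dots> = q * normal_density 0 q s"
      using \<open>q > 0\<close> by (simp add: normal_density_def real_sqrt_mult)
    finally show ?thesis .
  qed
  then have "(\<integral>s. exp (- (a * s\<^sup>2)) \<partial>std_normal_distribution) = (\<integral>s. q * normal_density 0 q s \<partial>lborel)"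
    by (subst integral_density) auto
  also have "\<dots> = q"
    using integral_normal_density[OF \<open>q > 0\<close>] by simp
  finally show ?thesis unfolding q_def .
qed

text \<open>
  The indicator of the ball is at most \<open>exp (1/2)\<close> times the Gaussian
  \<open>exp (- ((u \<bullet> Y)\<^sup>2 + (v \<bullet> Y)\<^sup>2) / (2 * r\<^sup>2))\<close>. The Gaussian is its own Fourier transform, so its
  expectation is an average of the characteristic function of \<open>Y\<close> over normally distributed
  frequencies of scale \<open>1 / r\<close> in the plane of \<open>u\<close> and \<open>v\<close>.
\<close>

lemma (in prob_space) small_ball_le_integral_char:
  fixes Y :: "'a \<Rightarrow> 'b::euclidean_space" and u v :: 'b
  defines "G \<equiv> std_normal_distribution \<Otimes>\<^sub>M std_normal_distribution"
  assumes Y [measurable]: "Y \<in> borel_measurable M"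
    and uv: "u \<in> Basis" "v \<in> Basis" "u \<noteq> v" and "r > 0"
  defines "\<phi> \<equiv> (\<lambda>z. char (distr M borel (\<lambda>\<omega>. ((fst z / r) *\<^sub>R u + (snd z / r) *\<^sub>R v) \<bullet> Y \<omega>)) 1)"
  shows "\<phi> \<in> borel_measurable G"
    and "prob {\<omega> \<in> space M. norm (Y \<omega>) \<le> r} \<le> exp (1/2) * (\<integral>z. cmod (\<phi> z) \<partial>G)"
proof -
  interpret N: prob_space std_normal_distribution
    by (rule prob_space_normal_density) simp
  interpret NN: pair_prob_space std_normal_distribution std_normal_distribution ..
  interpret G: prob_space G unfolding G_def by (rule NN.prob_space_axioms)
  interpret MG: pair_prob_space M G ..
  have sets_G [measurable_cong]: "sets G = sets (borel \<Otimes>\<^sub>M borel)"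
    unfolding G_def by (intro sets_pair_measure_cong) simp_all
  define f where "f = (\<lambda>\<omega> z. iexp (fst z * (u \<bullet> Y \<omega> / r) + snd z * (v \<bullet> Y \<omega> / r)))"
  have meas_f: "case_prod f \<in> borel_measurable (M \<Otimes>\<^sub>M G)"
    unfolding f_def case_prod_beta by measurable
  have int_f: "integrable (M \<Otimes>\<^sub>M G) (case_prod f)"
    by (rule MG.integrable_const_bound[of _ 1, OF _ meas_f]) (auto simp: f_def)
  have \<phi>_eq: "\<phi> z = (\<integral>\<omega>. f \<omega> z \<partial>M)" for z
    unfolding \<phi>_def char_def
    by (subst integral_distr) (auto simp: f_def inner_add_left)
  show meas_\<phi>: "\<phi> \<in> borel_measurable G"
    unfolding \<phi>_eq using meas_f
    by (intro borel_measurable_lebesgue_integral) (auto simp: case_prod_beta intro: measurable_pair_swap')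
  have inner: "(\<integral>z. f \<omega> z \<partial>G) = of_real (exp (- ((u \<bullet> Y \<omega>)\<^sup>2 + (v \<bullet> Y \<omega>)\<^sup>2) / (2 * r\<^sup>2)))" for \<omega>
  proof -
    have "integrable (std_normal_distribution \<Otimes>\<^sub>M std_normal_distribution) (f \<omega>)"
      by (rule NN.integrable_const_bound[of _ 1]) (auto simp: f_def)
    then have "(\<integral>z. f \<omega> z \<partial>G) = (\<integral>s. (\<integral>t. f \<omega> (s, t) \<partial>std_normal_distribution) \<partial>std_normal_distribution)"
      unfolding G_def by (rule NN.integral_fst'[symmetric])
    also have "\<dots> = (\<integral>s. iexp (s * (u \<bullet> Y \<omega> / r)) * char std_normal_distribution (v \<bullet> Y \<omega> / r) \<partial>std_normal_distribution)"
      unfolding f_def char_def by (simp add: distrib_left exp_add mult_ac)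
    also have "\<dots> = char std_normal_distribution (u \<bullet> Y \<omega> / r) * char std_normal_distribution (v \<bullet> Y \<omega> / r)"
      unfolding char_def[of _ "u \<bullet> Y \<omega> / r"] by (simp add: mult_ac)
    also have "\<dots> = of_real (exp (- ((u \<bullet> Y \<omega>)\<^sup>2 + (v \<bullet> Y \<omega>)\<^sup>2) / (2 * r\<^sup>2)))"
      unfolding char_std_normal_distribution of_real_mult[symmetric] exp_add[symmetric]
      using \<open>r > 0\<close> by (simp add: power_divide field_simps)
    finally show ?thesis .
  qed
  let ?g = "\<lambda>\<omega>. exp (- ((u \<bullet> Y \<omega>)\<^sup>2 + (v \<bullet> Y \<omega>)\<^sup>2) / (2 * r\<^sup>2))"
  have "?g \<omega> \<le> 1" for \<omega>
    by (simp add: divide_nonpos_nonneg)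
  then have int_g: "integrable M ?g"
    by (intro integrable_const_bound[of _ 1]) auto
  have "of_real (expectation ?g) = (\<integral>\<omega>. (\<integral>z. f \<omega> z \<partial>G) \<partial>M)"
    unfolding inner by simp
  also have "\<dots> = (\<integral>z. \<phi> z \<partial>G)"
    unfolding \<phi>_eq by (rule MG.Fubini_integral[OF int_f, symmetric])
  finally have "cmod (of_real (expectation ?g)) \<le> (\<integral>z. cmod (\<phi> z) \<partial>G)"
    by (metis integral_norm_bound)
  then have g_le: "expectation ?g \<le> (\<integral>z. cmod (\<phi> z) \<partial>G)"
    by simp
  have "prob {\<omega> \<in> space M. norm (Y \<omega>) \<le> r} = expectation (indicator {\<omega> \<in> space M. norm (Y \<omega>) \<le> r})"
    by simp
  also have "\<dots> \<le> expectation (\<lambda>\<omega>. exp (1/2) * ?g \<omega>)"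
  proof (rule integral_mono)
    fix \<omega> assume \<omega>: "\<omega> \<in> space M"
    show "indicator {\<omega> \<in> space M. norm (Y \<omega>) \<le> r} \<omega> \<le> exp (1/2) * ?g \<omega>"
    proof (cases "norm (Y \<omega>) \<le> r")
      case True
      have "(u \<bullet> Y \<omega>)\<^sup>2 + (v \<bullet> Y \<omega>)\<^sup>2 = (\<Sum>b\<in>{u, v}. (Y \<omega> \<bullet> b) * (Y \<omega> \<bullet> b))"
        using uv by (simp add: power2_eq_square inner_commute)
      also have "\<dots> \<le> (\<Sum>b\<in>Basis. (Y \<omega> \<bullet> b) * (Y \<omega> \<bullet> b))"
        using uv by (intro sum_mono2) auto
      also have "\<dots> = (norm (Y \<omega>))\<^sup>2"
        by (simp add: euclidean_inner[symmetric] power2_norm_eq_inner)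
      also have "\<dots> \<le> r\<^sup>2" using True by (intro power_mono) auto
      finally have "0 \<le> 1/2 + - ((u \<bullet> Y \<omega>)\<^sup>2 + (v \<bullet> Y \<omega>)\<^sup>2) / (2 * r\<^sup>2)"
        using \<open>r > 0\<close> by (simp add: field_simps)
      then show ?thesis using True \<omega> by (simp add: exp_add[symmetric])
    qed simp
  next
    show "integrable M (indicat_real {\<omega> \<in> space M. norm (Y \<omega>) \<le> r})"
      by (rule integrable_real_indicator) (simp_all add: emeasure_eq_measure)
  qed (use int_g in auto)
  also have "\<dots> \<le> exp (1/2) * (\<integral>z. cmod (\<phi> z) \<partial>G)"
    using g_le by simp
  finally show "prob {\<omega> \<in> space M. norm (Y \<omega>) \<le> r} \<le> exp (1/2) * (\<integral>z. cmod (\<phi> z) \<partial>G)" .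
qed

text \<open>
  Frequencies inside the ball of radius \<open>\<rho>\<close> contribute a planar Gaussian integral of order \<open>r\<^sup>2 / A\<close>; the
  others are rare, and Chebyshev's inequality bounds their share by the second term.
\<close>

lemma (in prob_space) small_ball_of_char_decay:
  fixes Y :: "'a \<Rightarrow> 'b::euclidean_space" and u v :: 'b
  assumes Y [measurable]: "Y \<in> borel_measurable M"
    and uv: "u \<in> Basis" "v \<in> Basis" "u \<noteq> v" and "r > 0" "A > 0" "\<rho> > 0"
    and decay: "\<And>w. norm w \<le> \<rho> \<Longrightarrow>
       cmod (char (distr M borel (\<lambda>\<omega>. w \<bullet> Y \<omega>)) 1) \<le> exp (- A * (norm w)\<^sup>2)"
  shows "prob {\<omega> \<in> space M. norm (Y \<omega>) \<le> r} \<le> exp (1/2) * (r\<^sup>2 / (2 * A) + 2 / (\<rho> * r)\<^sup>2)"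
proof -
  define G where "G = std_normal_distribution \<Otimes>\<^sub>M std_normal_distribution"
  define w where "w = (\<lambda>z :: real \<times> real. (fst z / r) *\<^sub>R u + (snd z / r) *\<^sub>R v)"
  define \<phi> where "\<phi> = (\<lambda>z. char (distr M borel (\<lambda>\<omega>. w z \<bullet> Y \<omega>)) 1)"
  interpret N: prob_space std_normal_distribution
    by (rule prob_space_normal_density) simp
  interpret NN: pair_prob_space std_normal_distribution std_normal_distribution ..
  interpret G: prob_space G unfolding G_def by (rule NN.prob_space_axioms)
  have sets_G [measurable_cong]: "sets G = sets (borel \<Otimes>\<^sub>M borel)"
    unfolding G_def by (intro sets_pair_measure_cong) simp_all
  have [measurable]: "\<phi> \<in> borel_measurable G"
    and smooth: "prob {\<omega> \<in> space M. norm (Y \<omega>) \<le> r} \<le> exp (1/2) * (\<integral>z. cmod (\<phi> z) \<partial>G)"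
    unfolding \<phi>_def w_def G_def by (rule small_ball_le_integral_char[OF Y uv \<open>r > 0\<close>])+
  have norm_w: "(norm (w z))\<^sup>2 = ((fst z)\<^sup>2 + (snd z)\<^sup>2) / r\<^sup>2" for z
  proof -
    have "u \<bullet> u = 1" "v \<bullet> v = 1" "u \<bullet> v = 0" "v \<bullet> u = 0"
      using uv by (simp_all add: inner_Basis)
    then show ?thesis
      unfolding power2_norm_eq_inner w_def inner_add_left inner_add_right
      by (simp add: power2_eq_square add_divide_distrib)
  qed
  define a where "a = A / r\<^sup>2"
  have "a > 0" using assms by (simp add: a_def)
  let ?e = "\<lambda>z. exp (- (a * (fst z)\<^sup>2)) * exp (- (a * (snd z)\<^sup>2))"
  let ?q = "\<lambda>z. ((fst z)\<^sup>2 + (snd z)\<^sup>2) / (\<rho> * r)\<^sup>2"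
  have char_le1: "cmod (\<phi> z) \<le> 1" for z
  proof -
    have "real_distribution (distr M borel (\<lambda>\<omega>. w z \<bullet> Y \<omega>))"
      by (rule real_distribution_distr) simp
    then show ?thesis unfolding \<phi>_def by (rule real_distribution.cmod_char_le_1)
  qed
  have bound: "cmod (\<phi> z) \<le> ?e z + ?q z" for z
  proof (cases "norm (w z) \<le> \<rho>")
    case True
    have "cmod (\<phi> z) \<le> exp (- A * (norm (w z))\<^sup>2)"
      unfolding \<phi>_def by (rule decay[OF True])
    also have "\<dots> = ?e z"
      by (simp add: norm_w a_def exp_add[symmetric] algebra_simps add_divide_distrib diff_divide_distrib)
    finally show ?thesis by (simp add: add_increasing2)
  next
    case False
    then have "\<rho>\<^sup>2 \<le> (norm (w z))\<^sup>2"
      using \<open>\<rho> > 0\<close> by (intro power_mono) auto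
    then have "1 \<le> ?q z"
      using \<open>\<rho> > 0\<close> \<open>r > 0\<close> by (simp add: norm_w power_mult_distrib field_simps)
    then show ?thesis using char_le1[of z] by (simp add: add_increasing)
  qed
  have int_e: "integrable G ?e"
    using \<open>a > 0\<close> by (intro G.integrable_const_bound[of _ 1]) (auto intro!: mult_le_one)
  have val_e: "(\<integral>z. ?e z \<partial>G) = 1 / (1 + 2 * a)"
  proof -
    have "(\<integral>z. ?e z \<partial>G) = (\<integral>s. (\<integral>t. ?e (s, t) \<partial>std_normal_distribution) \<partial>std_normal_distribution)"
      using int_e unfolding G_def by (rule NN.integral_fst'[symmetric])
    also have "\<dots> = 1 / sqrt (1 + 2 * a) * (1 / sqrt (1 + 2 * a))"
      using std_normal_integral_exp_square[of a] \<open>a > 0\<close> by simp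
    also have "\<dots> = 1 / (1 + 2 * a)" using \<open>a > 0\<close> by simp
    finally show ?thesis .
  qed
  have sq: "integrable std_normal_distribution (\<lambda>x. x\<^sup>2)" "(\<integral>x. x\<^sup>2 \<partial>std_normal_distribution) = 1"
    using std_normal_distribution_even_moments[of 1] by simp_all
  have fst_G: "distr G std_normal_distribution fst = std_normal_distribution"
    unfolding G_def by (rule N.distr_pair_fst)
  have swap_G: "distr G G (\<lambda>(x, y). (y, x)) = G"
    unfolding G_def by (rule NN.distr_pair_swap[symmetric])
  have int_fst: "integrable G (\<lambda>z. (fst z)\<^sup>2)" and val_fst: "(\<integral>z. (fst z)\<^sup>2 \<partial>G) = 1"
    using integrable_distr_eq[of fst G std_normal_distribution "\<lambda>x. x\<^sup>2"]
      integral_distr[of fst G std_normal_distribution "\<lambda>x. x\<^sup>2"] sq by (simp_all add: fst_G)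
  have int_snd: "integrable G (\<lambda>z. (snd z)\<^sup>2)" and val_snd: "(\<integral>z. (snd z)\<^sup>2 \<partial>G) = 1"
    using integrable_distr_eq[of "\<lambda>(x, y). (y, x)" G G "\<lambda>z. (fst z)\<^sup>2"]
      integral_distr[of "\<lambda>(x, y). (y, x)" G G "\<lambda>z. (fst z)\<^sup>2"] int_fst val_fst
    by (simp_all add: swap_G case_prod_beta)
  have "(\<integral>z. cmod (\<phi> z) \<partial>G) \<le> (\<integral>z. ?e z + ?q z \<partial>G)"
    by (intro integral_mono bound Bochner_Integration.integrable_add int_e integrable_divide int_fst int_snd
        G.integrable_const_bound[of _ 1]) (use char_le1 in auto)
  also have "\<dots> = 1 / (1 + 2 * a) + 2 / (\<rho> * r)\<^sup>2"
    using int_e int_fst int_snd val_e val_fst val_snd by simp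
  also have "1 / (1 + 2 * a) \<le> 1 / (2 * a)"
    using \<open>a > 0\<close> by (simp add: divide_simps)
  also have "1 / (2 * a) = r\<^sup>2 / (2 * A)"
    by (simp add: a_def)
  finally have "(\<integral>z. cmod (\<phi> z) \<partial>G) \<le> r\<^sup>2 / (2 * A) + 2 / (\<rho> * r)\<^sup>2" by simp
  then have "exp (1/2) * (\<integral>z. cmod (\<phi> z) \<partial>G) \<le> exp (1/2) * (r\<^sup>2 / (2 * A) + 2 / (\<rho> * r)\<^sup>2)"
    by (intro mult_left_mono) auto
  with smooth show ?thesis by (rule order_trans)
qed

section \<open>Growth of sums of orthogonal random variables\<close>

text \<open>
  Deleting the binary digits of \<open>n\<close> one after the other, starting with the lowest, writes \<open>S n\<close> as a sum of
  at most one increment over a dyadic interval of each length \<open>2 ^ l\<close>. The bound no longer depends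
  on \<open>n\<close>, so it controls the maximum of \<open>S\<close> up to \<open>2 ^ m\<close>.
\<close>

lemma dyadic_chaining:
  fixes S :: "nat \<Rightarrow> real"
  assumes "S 0 = 0" and "n \<le> 2 ^ m"
  shows "(S n)\<^sup>2 \<le> real (Suc m) * (\<Sum>l\<le>m. \<Sum>q<2 ^ (m - l). (S (Suc q * 2 ^ l) - S (q * 2 ^ l))\<^sup>2)"
proof -
  define f where "f = (\<lambda>l. S (n div 2 ^ l * 2 ^ l))"
  have telescope: "(\<Sum>l\<le>k. f l - f (Suc l)) = f 0 - f (Suc k)" for k
    by (induction k) auto
  have "n < 2 ^ Suc m" using assms(2) by (simp add: order.strict_trans1)
  then have "f (Suc m) = 0" using assms(1) by (simp only: f_def) simp
  then have Sn: "S n = (\<Sum>l\<le>m. f l - f (Suc l))"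
    unfolding telescope by (simp add: f_def)
  have le: "(f l - f (Suc l))\<^sup>2 \<le> (\<Sum>q<2 ^ (m - l). (S (Suc q * 2 ^ l) - S (q * 2 ^ l))\<^sup>2)" if "l \<le> m" for l
  proof -
    define p where "p = n div 2 ^ l"
    have p2: "n div 2 ^ Suc l = p div 2"
      unfolding p_def by (metis div_mult2_eq power_Suc2)
    have p_le: "p \<le> 2 ^ (m - l)"
    proof -
      have "p \<le> 2 ^ m div 2 ^ l" unfolding p_def by (rule div_le_mono[OF assms(2)])
      also have "\<dots> = 2 ^ (m - l)" using that by (simp add: power_diff)
      finally show ?thesis .
    qed
    have fS: "f (Suc l) = S (p div 2 * 2 * 2 ^ l)"
      unfolding f_def p2 by (simp add: mult.assoc)
    show ?thesis
    proof (cases "even p")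
      case True
      then have "f l = f (Suc l)" unfolding fS by (simp add: f_def p_def)
      then show ?thesis by (simp add: sum_nonneg)
    next
      case False
      then obtain q where q: "p = Suc q" "p div 2 * 2 = q"
        by (elim oddE) auto
      then have "(f l - f (Suc l))\<^sup>2 = (S (Suc q * 2 ^ l) - S (q * 2 ^ l))\<^sup>2"
        unfolding fS by (simp add: f_def p_def)
      also have "\<dots> \<le> (\<Sum>q<2 ^ (m - l). (S (Suc q * 2 ^ l) - S (q * 2 ^ l))\<^sup>2)"
        using p_le q(1) by (intro member_le_sum) auto
      finally show ?thesis .
    qed
  qed
  have "(S n)\<^sup>2 \<le> (\<Sum>l\<le>m. (f l - f (Suc l))\<^sup>2) * real (card {..m})"
    unfolding Sn by (rule sum_squared_le_sum_of_squares)
  also have "\<dots> \<le> (\<Sum>l\<le>m. \<Sum>q<2 ^ (m - l). (S (Suc q * 2 ^ l) - S (q * 2 ^ l))\<^sup>2) * real (card {..m})"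
    using le by (intro mult_right_mono sum_mono) auto
  finally show ?thesis by (simp add: mult.commute)
qed

lemma (in prob_space) orthogonal_increment_second_moment:
  fixes \<xi> :: "nat \<Rightarrow> 'a \<Rightarrow> real"
  assumes int: "\<And>i j. integrable M (\<lambda>\<omega>. \<xi> i \<omega> * \<xi> j \<omega>)"
    and orth: "\<And>i j. i \<noteq> j \<Longrightarrow> expectation (\<lambda>\<omega>. \<xi> i \<omega> * \<xi> j \<omega>) = 0"
    and var: "\<And>i. expectation (\<lambda>\<omega>. (\<xi> i \<omega>)\<^sup>2) \<le> V"
    and "a \<le> b"
  shows "integrable M (\<lambda>\<omega>. ((\<Sum>i=1..b. \<xi> i \<omega>) - (\<Sum>i=1..a. \<xi> i \<omega>))\<^sup>2)" (is ?int)
    and "expectation (\<lambda>\<omega>. ((\<Sum>i=1..b. \<xi> i \<omega>) - (\<Sum>i=1..a. \<xi> i \<omega>))\<^sup>2) \<le> V * (real b - real a)" (is ?le)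
proof -
  have "(\<Sum>i=1..b. \<xi> i \<omega>) - (\<Sum>i=1..a. \<xi> i \<omega>) = (\<Sum>i\<in>{a<..b}. \<xi> i \<omega>)" for \<omega>
  proof -
    have "{1..b} = {1..a} \<union> {a<..b}" using \<open>a \<le> b\<close> by auto
    then have "(\<Sum>i=1..b. \<xi> i \<omega>) = (\<Sum>i=1..a. \<xi> i \<omega>) + (\<Sum>i\<in>{a<..b}. \<xi> i \<omega>)"
      by (simp only:) (rule sum.union_disjoint, auto)
    then show ?thesis by simp
  qed
  then have sq: "((\<Sum>i=1..b. \<xi> i \<omega>) - (\<Sum>i=1..a. \<xi> i \<omega>))\<^sup>2
      = (\<Sum>i\<in>{a<..b}. \<Sum>j\<in>{a<..b}. \<xi> i \<omega> * \<xi> j \<omega>)" for \<omega>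
    by (simp add: power2_eq_square sum_product)
  show ?int
    unfolding sq by (intro Bochner_Integration.integrable_sum int)
  have "expectation (\<lambda>\<omega>. ((\<Sum>i=1..b. \<xi> i \<omega>) - (\<Sum>i=1..a. \<xi> i \<omega>))\<^sup>2)
      = (\<Sum>i\<in>{a<..b}. \<Sum>j\<in>{a<..b}. expectation (\<lambda>\<omega>. \<xi> i \<omega> * \<xi> j \<omega>))"
    unfolding sq using int by (simp add: Bochner_Integration.integral_sum)
  also have "\<dots> = (\<Sum>i\<in>{a<..b}. \<Sum>j\<in>{a<..b}. if i = j then expectation (\<lambda>\<omega>. (\<xi> i \<omega>)\<^sup>2) else 0)"
    using orth by (intro sum.cong refl) (auto simp: power2_eq_square)
  also have "\<dots> = (\<Sum>i\<in>{a<..b}. expectation (\<lambda>\<omega>. (\<xi> i \<omega>)\<^sup>2))"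
    by (intro sum.cong refl) simp
  also have "\<dots> \<le> (\<Sum>i\<in>{a<..b}. V)"
    by (intro sum_mono var)
  also have "\<dots> = V * (real b - real a)"
    using \<open>a \<le> b\<close> by (simp add: of_nat_diff mult.commute)
  finally show ?le .
qed

text \<open>
  A weak form of the Rademacher--Menshov theorem. The chaining bound \<open>W m\<close> has expectation of order
  \<open>m * 2 ^ m\<close>, so by Markov and Borel--Cantelli it is below \<open>2 powr (m * (1 + \<delta>))\<close> for all large \<open>m\<close>;
  the spare factor \<open>2 powr (m * \<delta>)\<close> absorbs the polynomial losses.
\<close>

lemma (in prob_space) orthogonal_sums_growth:
  fixes \<xi> :: "nat \<Rightarrow> 'a \<Rightarrow> real"
  assumes int: "\<And>i j. integrable M (\<lambda>\<omega>. \<xi> i \<omega> * \<xi> j \<omega>)"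
    and orth: "\<And>i j. i \<noteq> j \<Longrightarrow> expectation (\<lambda>\<omega>. \<xi> i \<omega> * \<xi> j \<omega>) = 0"
    and var: "\<And>i. expectation (\<lambda>\<omega>. (\<xi> i \<omega>)\<^sup>2) \<le> V"
    and "\<delta> > 0"
  shows "AE \<omega> in M. eventually (\<lambda>n. \<bar>\<Sum>i=1..n. \<xi> i \<omega>\<bar> \<le> real n powr (1/2 + \<delta>)) sequentially"
proof -
  define S where "S = (\<lambda>n \<omega>. \<Sum>i=1..n. \<xi> i \<omega>)"
  define W where "W = (\<lambda>m \<omega>. \<Sum>l\<le>m. \<Sum>q<2 ^ (m - l). (S (Suc q * 2 ^ l) \<omega> - S (q * 2 ^ l) \<omega>)\<^sup>2)"
  define x where "x = 2 powr (- \<delta>)"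
  have x: "0 < x" "x < 1"
    using \<open>\<delta> > 0\<close> by (simp_all add: x_def powr_less_one)
  have incr: "integrable M (\<lambda>\<omega>. (S b \<omega> - S a \<omega>)\<^sup>2)"
    "expectation (\<lambda>\<omega>. (S b \<omega> - S a \<omega>)\<^sup>2) \<le> V * (real b - real a)" if "a \<le> b" for a b
    unfolding S_def by (rule orthogonal_increment_second_moment[OF int orth var that]; simp)+
  have incr_mono: "q * 2 ^ l \<le> Suc q * 2 ^ l" for q l :: nat by simp
  have W_int: "integrable M (W m)" for m
    unfolding W_def by (intro Bochner_Integration.integrable_sum incr(1) incr_mono)
  then have W_meas [measurable]: "W m \<in> borel_measurable M" for m by auto
  have W_nonneg: "0 \<le> W m \<omega>" for m \<omega>
    unfolding W_def by (intro sum_nonneg) auto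
  have W_exp: "expectation (W m) \<le> V * (real (Suc m) * 2 ^ m)" for m
  proof -
    have "expectation (W m) = (\<Sum>l\<le>m. \<Sum>q<2 ^ (m - l).
        expectation (\<lambda>\<omega>. (S (Suc q * 2 ^ l) \<omega> - S (q * 2 ^ l) \<omega>)\<^sup>2))"
      unfolding W_def using incr(1)[OF incr_mono]
      by (simp only: Bochner_Integration.integral_sum Bochner_Integration.integrable_sum)
    also have "\<dots> \<le> (\<Sum>l\<le>m. \<Sum>q<2 ^ (m - l). V * (real (Suc q * 2 ^ l) - real (q * 2 ^ l)))"
      by (intro sum_mono incr(2) incr_mono)
    also have "\<dots> = (\<Sum>l\<le>m. V * 2 ^ m)"
      by (intro sum.cong refl) (simp add: algebra_simps power_add[symmetric])
    finally show ?thesis by (simp add: algebra_simps)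
  qed
  define A where "A = (\<lambda>m. {\<omega> \<in> space M. W m \<omega> \<ge> 2 powr (real m * (1 + \<delta>))})"
  have [measurable]: "A m \<in> sets M" for m unfolding A_def by measurable
  have pow2: "2 powr (real m * (1 + \<delta>)) = 2 ^ m / x ^ m" for m
    by (simp add: x_def powr_minus powr_add distrib_left powr_realpow powr_power divide_simps mult.commute)
  have PA: "prob (A m) \<le> V * (real (Suc m) * x ^ m)" for m
  proof -
    have "prob (A m) \<le> expectation (W m) / 2 powr (real m * (1 + \<delta>))"
      unfolding A_def by (intro integral_Markov_inequality_measure[where A = "{}"] W_int) (auto simp: W_nonneg)
    also have "\<dots> \<le> V * (real (Suc m) * 2 ^ m) / 2 powr (real m * (1 + \<delta>))"
      by (intro divide_right_mono W_exp) simp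
    also have "\<dots> = V * (real (Suc m) * x ^ m)"
      using x unfolding pow2 by (simp add: field_simps)
    finally show ?thesis .
  qed
  have "summable (\<lambda>m. prob (A m))"
  proof (rule summable_comparison_test')
    show "summable (\<lambda>m. V * (real (Suc m) * x ^ m))"
      using x geometric_deriv_sums[of x] by (intro summable_mult) (auto simp: sums_iff)
  qed (use PA in auto)
  then have "AE \<omega> in M. eventually (\<lambda>m. \<omega> \<in> space M - A m) sequentially"
    by (intro borel_cantelli_AE1) (auto simp: emeasure_eq_measure)
  moreover have "eventually (\<lambda>n. \<bar>S n \<omega>\<bar> \<le> real n powr (1/2 + \<delta>)) sequentially"
    if "eventually (\<lambda>m. \<omega> \<in> space M - A m) sequentially" for \<omega>
  proof -
    have "((\<lambda>m. (real m + 2) * 2 powr ((real m + 1) * (1 + \<delta>)) / 2 powr (real m * (1 + 2 * \<delta>))) \<longlongrightarrow> 0) sequentially"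
      using \<open>\<delta> > 0\<close> by real_asymp
    then have "eventually (\<lambda>m. (real m + 2) * 2 powr ((real m + 1) * (1 + \<delta>)) / 2 powr (real m * (1 + 2 * \<delta>)) < 1) sequentially"
      by (rule order_tendstoD) simp
    from eventually_conj[OF that this] obtain m0 where m0:
      "\<And>m. m \<ge> m0 \<Longrightarrow> W m \<omega> < 2 powr (real m * (1 + \<delta>))"
      "\<And>m. m \<ge> m0 \<Longrightarrow> (real m + 2) * 2 powr ((real m + 1) * (1 + \<delta>)) < 2 powr (real m * (1 + 2 * \<delta>))"
      unfolding A_def eventually_sequentially by (auto simp: not_le)
    have "\<bar>S n \<omega>\<bar> \<le> real n powr (1/2 + \<delta>)" if n: "n \<ge> 2 ^ m0" for n
    proof -
      have "0 < (2::nat) ^ m0" by simp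
      then have "n > 0" using n by linarith
      obtain m where m: "2 ^ m \<le> n" "n < 2 ^ (m + 1)"
        using ex_power_ivl1[of 2 n] \<open>n > 0\<close> by auto
      have "m0 \<le> m"
      proof -
        have "(2::nat) ^ m0 < 2 ^ (m + 1)" using n m by linarith
        then have "m0 < m + 1" by (rule power_less_imp_less_exp[rotated]) simp
        then show ?thesis by simp
      qed
      have "(S n \<omega>)\<^sup>2 \<le> real (Suc (Suc m)) * W (Suc m) \<omega>"
        unfolding W_def using m by (intro dyadic_chaining) (auto simp: S_def)
      also have "\<dots> \<le> (real m + 2) * 2 powr ((real m + 1) * (1 + \<delta>))"
        using m0(1)[of "Suc m"] \<open>m0 \<le> m\<close> by (intro mult_mono) (auto simp: W_nonneg algebra_simps)
      also have "\<dots> \<le> 2 powr (real m * (1 + 2 * \<delta>))"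
        using m0(2)[OF \<open>m0 \<le> m\<close>] by simp
      also have "\<dots> = real (2 ^ m) powr (1 + 2 * \<delta>)"
        by (simp add: powr_realpow[symmetric] powr_powr)
      also have "\<dots> \<le> real n powr (1 + 2 * \<delta>)"
        using m(1) \<open>\<delta> > 0\<close> by (intro powr_mono2) (simp_all del: of_nat_power)
      also have "\<dots> = (real n powr (1/2 + \<delta>))\<^sup>2"
        using \<open>n > 0\<close> by (simp add: powr_power mult.commute distrib_left)
      finally show ?thesis by (simp add: abs_le_square_iff[symmetric])
    qed
    then show ?thesis unfolding eventually_sequentially by blast
  qed
  ultimately show ?thesis unfolding S_def by (auto elim: eventually_mono)
qed

section \<open>Growth of partial sums, deterministically\<close>

lemma power_bracket:
  fixes n b :: nat
  assumes "b \<ge> 1"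
  obtains k where "k ^ b \<le> n" "n < Suc k ^ b"
proof -
  have "n < Suc n ^ b"
    using assms self_le_power[of "Suc n" b] by simp
  then have "\<exists>j. n < j ^ b" by blast
  moreover define j where "j = (LEAST j. n < j ^ b)"
  ultimately have "n < j ^ b" by (metis LeastI)
  then obtain k where k: "j = Suc k" using assms by (cases j) (auto simp: power_0_left)
  have "\<not> n < k ^ b"
    using not_less_Least[of k "\<lambda>j. n < j ^ b"] k unfolding j_def by simp
  with that \<open>n < j ^ b\<close> k show thesis by (simp add: not_less)
qed

lemma power_Suc_diff_le:
  fixes k b :: nat
  shows "real (Suc k ^ b) - real (k ^ b) \<le> real b * real (Suc k) ^ (b - 1)"
proof (cases b)
  case (Suc c)
  have "real (Suc k) ^ Suc c - real k ^ Suc c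
      = (\<Sum>p<Suc c. real (Suc k) ^ p * real k ^ (c - p))"
    by (subst diff_power_eq_sum) simp
  also have "\<dots> \<le> (\<Sum>p<Suc c. real (Suc k) ^ c)"
  proof (rule sum_mono)
    fix p assume "p \<in> {..<Suc c}"
    then have "real (Suc k) ^ p * real (Suc k) ^ (c - p) = real (Suc k) ^ c"
      by (simp add: power_add[symmetric])
    then show "real (Suc k) ^ p * real k ^ (c - p) \<le> real (Suc k) ^ c"
      by (metis mult_left_mono of_nat_0_le_iff of_nat_le_iff le_Suc_eq order_refl power_mono zero_le_power)
  qed
  finally show ?thesis unfolding Suc by (simp only: of_nat_power card_lessThan sum_constant diff_Suc_1)
qed simp

text \<open>
  Between the checkpoints \<open>k ^ b\<close> and \<open>Suc k ^ b\<close> the partial sum moves by at most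
  \<open>O(k powr (b - 1)) * O(k powr (b/2 + 1/8))\<close>, which is smaller than the lower bound at the checkpoint by
  a factor \<open>k powr (1/8)\<close>. The final exponent \<open>1/b\<close> exceeds the \<open>3/(4*b)\<close> available at the checkpoints
  in order to absorb the replacement of \<open>k\<close> by \<open>Suc k\<close>.
\<close>

lemma partial_sums_lower_growth:
  fixes s :: "nat \<Rightarrow> 'v::real_normed_vector" and b :: nat and K :: real
  defines "T \<equiv> (\<lambda>n. \<Sum>i=1..n. s i)"
  assumes b: "b \<ge> 1" and "K > 0"
    and growth: "eventually (\<lambda>n. norm (s n) \<le> K * real n powr (1/2 + 1 / (8 * real b))) sequentially"
    and checkpoints: "eventually (\<lambda>k. norm (T (k ^ b)) > 2 * real k powr (3 * real b / 2 - 3/4)) sequentially"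
  shows "eventually (\<lambda>n. norm (T n) \<ge> real n powr (3/2 - 1 / real b)) sequentially"
proof -
  let ?x = "1/2 + 1 / (8 * real b)"
  have "?x > 0" by (simp add: add_pos_nonneg)
  have "((\<lambda>k. K * real b * (real k + 1) powr (real b - 1) * (real k + 1) powr (real b / 2 + 1/8)
      / real k powr (3 * real b / 2 - 3/4)) \<longlongrightarrow> 0) sequentially"
    by real_asymp
  then have ev1: "eventually (\<lambda>k. K * real b * (real k + 1) powr (real b - 1) * (real k + 1) powr (real b / 2 + 1/8)
      / real k powr (3 * real b / 2 - 3/4) < 1) sequentially"
    by (rule order_tendstoD) simp
  have "((\<lambda>k. (real k + 1) powr (3 * real b / 2 - 1) / real k powr (3 * real b / 2 - 3/4)) \<longlongrightarrow> 0) sequentially"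
    by real_asymp
  then have ev2: "eventually (\<lambda>k. (real k + 1) powr (3 * real b / 2 - 1) / real k powr (3 * real b / 2 - 3/4) < 1) sequentially"
    by (rule order_tendstoD) simp
  from growth obtain n0 where n0: "\<And>n. n \<ge> n0 \<Longrightarrow> norm (s n) \<le> K * real n powr ?x"
    by (auto simp: eventually_sequentially)
  from eventually_conj[OF checkpoints eventually_conj[OF ev1 ev2]] obtain k0 where k0:
    "\<And>k. k \<ge> k0 \<Longrightarrow> norm (T (k ^ b)) > 2 * real k powr (3 * real b / 2 - 3/4)"
    "\<And>k. k \<ge> k0 \<Longrightarrow> K * real b * (real k + 1) powr (real b - 1) * (real k + 1) powr (real b / 2 + 1/8)
      / real k powr (3 * real b / 2 - 3/4) < 1"
    "\<And>k. k \<ge> k0 \<Longrightarrow> (real k + 1) powr (3 * real b / 2 - 1) / real k powr (3 * real b / 2 - 3/4) < 1"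
    unfolding eventually_sequentially by blast
  have "norm (T n) \<ge> real n powr (3/2 - 1 / real b)" if n: "n \<ge> (max (max n0 k0) 1 + 1) ^ b" for n
  proof -
    obtain k where k: "k ^ b \<le> n" "n < Suc k ^ b"
      using power_bracket[OF b] .
    have "(max (max n0 k0) 1 + 1) ^ b < Suc k ^ b" using n k by linarith
    then have "max (max n0 k0) 1 + 1 < Suc k" by (rule power_less_imp_less_base) simp
    then have "n0 \<le> k" "k0 \<le> k" "1 \<le> k" by auto
    have "k \<le> k ^ b" using b \<open>1 \<le> k\<close> by (intro self_le_power) auto
    then have "n0 \<le> k ^ b" using \<open>n0 \<le> k\<close> by linarith
    define R where "R = real k powr (3 * real b / 2 - 3/4)"
    have "R > 0" using \<open>1 \<le> k\<close> by (simp add: R_def)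
    have Suc_powr: "real (Suc k ^ b) powr y = (real k + 1) powr (real b * y)" for y
      by (simp add: powr_realpow[symmetric] powr_powr add.commute)
    have bx: "real b * ?x = real b / 2 + 1/8" using b by (simp add: field_simps)
    have split: "T n - T (k ^ b) = (\<Sum>i\<in>{k ^ b<..n}. s i)"
    proof -
      have "{1..n} = {1..k ^ b} \<union> {k ^ b<..n}" using k by auto
      then have "T n = T (k ^ b) + (\<Sum>i\<in>{k ^ b<..n}. s i)"
        unfolding T_def by (simp only:) (rule sum.union_disjoint, auto)
      then show ?thesis by simp
    qed
    have "norm (T n - T (k ^ b)) \<le> real (card {k ^ b<..n}) * (K * (real k + 1) powr (real b / 2 + 1/8))"
      unfolding split
    proof (rule sum_norm_bound)
      fix i assume i: "i \<in> {k ^ b<..n}"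
      then have "norm (s i) \<le> K * real i powr ?x"
        using \<open>n0 \<le> k ^ b\<close> by (intro n0) auto
      also have "\<dots> \<le> K * real (Suc k ^ b) powr ?x"
        using i k \<open>K > 0\<close> \<open>?x > 0\<close> by (intro mult_left_mono powr_mono2) (auto simp del: of_nat_power of_nat_Suc)
      finally show "norm (s i) \<le> K * (real k + 1) powr (real b / 2 + 1/8)"
        unfolding Suc_powr bx .
    qed
    also have "\<dots> \<le> (real b * (real k + 1) powr (real b - 1)) * (K * (real k + 1) powr (real b / 2 + 1/8))"
    proof (intro mult_right_mono)
      have "real (card {k ^ b<..n}) \<le> real (Suc k ^ b) - real (k ^ b)"
        using k by (simp add: of_nat_diff del: of_nat_power of_nat_Suc)
      also have "\<dots> \<le> real b * real (Suc k) ^ (b - 1)" by (rule power_Suc_diff_le)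
      also have "real (Suc k) ^ (b - 1) = (real k + 1) powr (real b - 1)"
        using b by (simp add: powr_realpow[symmetric] of_nat_diff add.commute)
      finally show "real (card {k ^ b<..n}) \<le> real b * (real k + 1) powr (real b - 1)" .
    qed (use \<open>K > 0\<close> in auto)
    also have "\<dots> \<le> R"
      using k0(2)[OF \<open>k0 \<le> k\<close>] \<open>R > 0\<close> unfolding R_def[symmetric] by (simp add: divide_less_eq mult_ac)
    finally have diff: "norm (T n - T (k ^ b)) \<le> R" .
    have "real n powr (3/2 - 1 / real b) \<le> real (Suc k ^ b) powr (3/2 - 1 / real b)"
      using k b by (intro powr_mono2) (auto simp: field_simps simp del: of_nat_power of_nat_Suc)
    also have "\<dots> = (real k + 1) powr (3 * real b / 2 - 1)"
    proof -
      have "real b * (3/2 - 1 / real b) = 3 * real b / 2 - 1" using b by (simp add: field_simps)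
      then show ?thesis unfolding Suc_powr by simp
    qed
    also have "\<dots> \<le> R"
      using k0(3)[OF \<open>k0 \<le> k\<close>] \<open>R > 0\<close> unfolding R_def[symmetric] by (simp add: divide_less_eq)
    also have "R \<le> norm (T (k ^ b)) - norm (T n - T (k ^ b))"
      using k0(1)[OF \<open>k0 \<le> k\<close>] diff unfolding R_def[symmetric] by simp
    also have "\<dots> \<le> norm (T n)"
      using norm_triangle_ineq2[of "T (k ^ b)" "T (k ^ b) - T n"] by (simp add: norm_minus_commute)
    finally show ?thesis .
  qed
  then show ?thesis unfolding eventually_sequentially by blast
qed

lemma partial_sums_upper_growth:
  fixes s :: "nat \<Rightarrow> 'v::real_normed_vector"
  assumes "K > 0" "0 < \<delta>" "\<delta> < \<eta>" "y \<ge> 0"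
    and growth: "eventually (\<lambda>n. norm (s n) \<le> K * real n powr (y + \<delta>)) sequentially"
  shows "eventually (\<lambda>n. norm (\<Sum>i=1..n. s i) \<le> real n powr (1 + y + \<eta>)) sequentially"
proof -
  from growth obtain n0 where n0: "\<And>n. n \<ge> n0 \<Longrightarrow> norm (s n) \<le> K * real n powr (y + \<delta>)"
    by (auto simp: eventually_sequentially)
  define B where "B = (\<Sum>i=1..n0. norm (s i))"
  have "((\<lambda>n. (B + K * real n powr (1 + y + \<delta>)) / real n powr (1 + y + \<eta>)) \<longlongrightarrow> 0) sequentially"
    using assms by real_asymp
  then have "eventually (\<lambda>n. (B + K * real n powr (1 + y + \<delta>)) / real n powr (1 + y + \<eta>) < 1) sequentially"
    by (rule order_tendstoD) simp
  with eventually_ge_at_top[of "max 1 n0"] show ?thesis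
  proof eventually_elim
    case (elim n)
    have "{1..n} = {1..n0} \<union> {n0<..n}" using elim by auto
    then have "(\<Sum>i=1..n. s i) = (\<Sum>i=1..n0. s i) + (\<Sum>i\<in>{n0<..n}. s i)"
      by (simp only:) (rule sum.union_disjoint, auto)
    then have "norm (\<Sum>i=1..n. s i) \<le> norm (\<Sum>i=1..n0. s i) + norm (\<Sum>i\<in>{n0<..n}. s i)"
      using norm_triangle_ineq by simp
    also have "norm (\<Sum>i=1..n0. s i) \<le> B" unfolding B_def by (rule norm_sum)
    also have "norm (\<Sum>i\<in>{n0<..n}. s i) \<le> real (card {n0<..n}) * (K * real n powr (y + \<delta>))"
    proof (rule sum_norm_bound)
      fix i assume i: "i \<in> {n0<..n}"
      then have "norm (s i) \<le> K * real i powr (y + \<delta>)" by (intro n0) auto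
      also have "\<dots> \<le> K * real n powr (y + \<delta>)"
        using i assms by (intro mult_left_mono powr_mono2) auto
      finally show "norm (s i) \<le> K * real n powr (y + \<delta>)" .
    qed
    also have "\<dots> \<le> real n * (K * real n powr (y + \<delta>))"
      using assms by (intro mult_right_mono) auto
    also have "\<dots> = K * real n powr (1 + y + \<delta>)"
      using elim by (simp add: powr_add)
    also have "B + K * real n powr (1 + y + \<delta>) \<le> real n powr (1 + y + \<eta>)"
      using elim by (simp add: divide_less_eq split: if_splits)
    finally show ?case by simp
  qed
qed

lemma elog_ratio_tendsto:
  fixes g :: "nat \<Rightarrow> real"
  assumes bounds: "\<And>\<delta>. \<delta> > 0 \<Longrightarrow> eventually (\<lambda>n. real n powr (a - \<delta>) \<le> g n \<and> g n \<le> real n powr (a + \<delta>)) sequentially"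
  shows "(\<lambda>n. elog (g n) / ereal (ln (real n))) \<longlonglongrightarrow> ereal a"
proof -
  have pos: "g n > 0" if "real n powr y \<le> g n" "n \<ge> 2" for n y
  proof -
    have "real n powr y > 0" using that(2) by simp
    with that(1) show ?thesis by linarith
  qed
  have "(\<lambda>n. ln (g n) / ln (real n)) \<longlonglongrightarrow> a"
  proof (rule tendstoI)
    fix e :: real assume "e > 0"
    have "eventually (\<lambda>n. real n powr (a - e/2) \<le> g n \<and> g n \<le> real n powr (a + e/2)) sequentially"
      using \<open>e > 0\<close> by (intro bounds) simp
    with eventually_ge_at_top[of 2]
    show "eventually (\<lambda>n. dist (ln (g n) / ln (real n)) a < e) sequentially"
    proof eventually_elim
      case (elim n)
      have "g n > 0" using pos elim by blast
      have "ln (real n) > 0" using elim by simp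
      have "(a - e/2) * ln (real n) = ln (real n powr (a - e/2))"
        using elim by (simp add: ln_powr)
      also have "\<dots> \<le> ln (g n)"
        using elim \<open>g n > 0\<close> by (subst ln_le_cancel_iff) auto
      finally have lower: "a - e/2 \<le> ln (g n) / ln (real n)"
        using \<open>ln (real n) > 0\<close> by (simp add: le_divide_eq)
      have "ln (g n) \<le> ln (real n powr (a + e/2))"
        using elim \<open>g n > 0\<close> by (subst ln_le_cancel_iff) auto
      also have "\<dots> = (a + e/2) * ln (real n)"
        using elim by (simp add: ln_powr)
      finally have "ln (g n) / ln (real n) \<le> a + e/2"
        using \<open>ln (real n) > 0\<close> by (simp add: divide_le_eq)
      with lower \<open>e > 0\<close> show ?case by (simp add: dist_real_def abs_less_iff)
    qed
  qed
  then have "(\<lambda>n. ereal (ln (g n) / ln (real n))) \<longlonglongrightarrow> ereal a" by simp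
  moreover have "eventually (\<lambda>n. ereal (ln (g n) / ln (real n)) = elog (g n) / ereal (ln (real n))) sequentially"
    using eventually_ge_at_top[of 2] bounds[of 1, simplified]
  proof eventually_elim
    case (elim n)
    then have "g n > 0" using pos by blast
    moreover have "ln (real n) \<noteq> 0" using elim by simp
    ultimately show ?case by (simp add: elog_def)
  qed
  ultimately show ?thesis by (rule Lim_transform_eventually)
qed

section \<open>Sums of the positions of the walk\<close>

lemma sum_walk:
  "(\<Sum>i=1..n. walk X i \<omega>) = (\<Sum>j=1..n. real (n + 1 - j) *\<^sub>R X j \<omega>)"
proof (induction n)
  case (Suc n)
  have "(\<Sum>j=1..Suc n. real (Suc n + 1 - j) *\<^sub>R X j \<omega>)
      = (\<Sum>j=1..n. real (Suc n + 1 - j) *\<^sub>R X j \<omega>) + X (Suc n) \<omega>"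
    by simp
  also have "(\<Sum>j=1..n. real (Suc n + 1 - j) *\<^sub>R X j \<omega>)
      = (\<Sum>j=1..n. real (n + 1 - j) *\<^sub>R X j \<omega> + X j \<omega>)"
  proof (intro sum.cong refl)
    fix j assume "j \<in> {1..n}"
    then have "real (Suc n + 1 - j) = real (n + 1 - j) + 1" by (simp add: of_nat_diff)
    then show "real (Suc n + 1 - j) *\<^sub>R X j \<omega> = real (n + 1 - j) *\<^sub>R X j \<omega> + X j \<omega>"
      by (simp only: scaleR_add_left scaleR_one)
  qed
  also have "\<dots> = (\<Sum>i=1..n. walk X i \<omega>) + (\<Sum>j=1..n. X j \<omega>)"
    by (simp only: sum.distrib Suc.IH)
  finally show ?case by (simp add: walk_def add.assoc)
qed simp

lemma sum_squares_ge: "real n ^ 3 / 3 \<le> (\<Sum>j=1..n. (real (n + 1 - j))\<^sup>2)"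
proof -
  have "real n ^ 3 / 3 \<le> (\<Sum>j=1..n. (real j)\<^sup>2)"
  proof (induction n)
    case (Suc n)
    have "real (Suc n) ^ 3 / 3 \<le> real n ^ 3 / 3 + (real (Suc n))\<^sup>2"
      by (simp add: power2_eq_square power3_eq_cube field_simps)
    with Suc show ?case by simp
  qed simp
  also have "\<dots> = (\<Sum>j=1..n. (real (n + 1 - j))\<^sup>2)"
    by (rule sum.atLeastAtMost_rev)
  finally show ?thesis .
qed

context prob_space
begin

text \<open>
  All the frequencies \<open>(n + 1 - j) *\<^sub>R w\<close> stay in the ball of radius \<open>\<kappa>\<close>, where each factor has a Gaussian
  bound; the exponents add up to a sum of squares of order \<open>n ^ 3\<close>.
\<close>

lemma walk_sum_char_decay:
  fixes X :: "nat \<Rightarrow> 'a \<Rightarrow> real^'n"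
  assumes indep: "indep_vars (\<lambda>_. borel) X UNIV"
    and ident: "\<And>i. distr M borel (X i) = distr M borel (X 0)"
    and "c > 0"
    and decay: "\<And>w. norm w \<le> \<kappa> \<Longrightarrow>
       cmod (char (distr M borel (\<lambda>\<omega>. w \<bullet> X 0 \<omega>)) 1) \<le> exp (- c * (norm w)\<^sup>2)"
    and "n \<ge> 1" and w: "norm w \<le> \<kappa> / real n"
  shows "cmod (char (distr M borel (\<lambda>\<omega>. w \<bullet> (\<Sum>i=1..n. walk X i \<omega>))) 1)
    \<le> exp (- (c * real n ^ 3 / 3) * (norm w)\<^sup>2)"
proof -
  have [measurable]: "X i \<in> borel_measurable M" for i
    using indep unfolding indep_vars_def by simp
  define a where "a = (\<lambda>j. real (n + 1 - j))"
  have eq: "w \<bullet> (\<Sum>i=1..n. walk X i \<omega>) = (\<Sum>j=1..n. (a j *\<^sub>R w) \<bullet> X j \<omega>)" for \<omega>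
    unfolding sum_walk a_def by (simp only: inner_sum_right inner_scaleR_right inner_scaleR_left)
  have ident_inner: "distr M borel (\<lambda>\<omega>. v \<bullet> X j \<omega>) = distr M borel (\<lambda>\<omega>. v \<bullet> X 0 \<omega>)" for v j
    using distr_distr[of "\<lambda>x. v \<bullet> x" borel borel "X j" M] distr_distr[of "\<lambda>x. v \<bullet> x" borel borel "X 0" M] ident[of j]
    by (simp add: comp_def)
  have "indep_vars (\<lambda>_. borel) (\<lambda>j \<omega>. (a j *\<^sub>R w) \<bullet> X j \<omega>) {1..n}"
    by (rule indep_vars_compose2[OF indep_vars_subset[OF indep]]) auto
  then have "char (distr M borel (\<lambda>\<omega>. w \<bullet> (\<Sum>i=1..n. walk X i \<omega>))) 1
      = (\<Prod>j=1..n. char (distr M borel (\<lambda>\<omega>. (a j *\<^sub>R w) \<bullet> X 0 \<omega>)) 1)"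
    unfolding eq by (simp only: char_distr_sum) (intro prod.cong refl arg_cong2[where f = char] ident_inner)
  then have "cmod (char (distr M borel (\<lambda>\<omega>. w \<bullet> (\<Sum>i=1..n. walk X i \<omega>))) 1)
      = (\<Prod>j=1..n. cmod (char (distr M borel (\<lambda>\<omega>. (a j *\<^sub>R w) \<bullet> X 0 \<omega>)) 1))"
    by (simp only: prod_norm)
  also have "\<dots> \<le> (\<Prod>j=1..n. exp (- c * (norm (a j *\<^sub>R w))\<^sup>2))"
  proof (intro prod_mono conjI decay)
    fix j assume j: "j \<in> {1..n}"
    have "0 \<le> a j" "a j \<le> real n" using j by (auto simp: a_def)
    then have "norm (a j *\<^sub>R w) \<le> real n * norm w"
      by (simp add: mult_right_mono)
    also have "\<dots> \<le> real n * (\<kappa> / real n)"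
      using w by (intro mult_left_mono) auto
    finally have "norm (a j *\<^sub>R w) \<le> real n * (\<kappa> / real n)" .
    then show "norm (a j *\<^sub>R w) \<le> \<kappa>" using \<open>n \<ge> 1\<close> by simp
  qed simp
  also have "\<dots> = exp (- (c * (norm w)\<^sup>2) * (\<Sum>j=1..n. (a j)\<^sup>2))"
    by (simp add: exp_sum[symmetric] sum_distrib_left power_mult_distrib mult_ac sum_negf)
  also have "\<dots> \<le> exp (- (c * (norm w)\<^sup>2) * (real n ^ 3 / 3))"
    using sum_squares_ge[of n] \<open>c > 0\<close> by (auto simp: a_def intro!: mult_left_mono)
  also have "\<dots> = exp (- (c * real n ^ 3 / 3) * (norm w)\<^sup>2)"
    by (simp add: mult_ac)
  finally show ?thesis .
qed

lemma walk_sum_small_ball: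
  fixes X :: "nat \<Rightarrow> 'a \<Rightarrow> real^'n"
  assumes indep: "indep_vars (\<lambda>_. borel) X UNIV"
    and ident: "\<And>i. distr M borel (X i) = distr M borel (X 0)"
    and "c > 0" "\<kappa> > 0"
    and decay: "\<And>w. norm w \<le> \<kappa> \<Longrightarrow>
       cmod (char (distr M borel (\<lambda>\<omega>. w \<bullet> X 0 \<omega>)) 1) \<le> exp (- c * (norm w)\<^sup>2)"
    and dim: "CARD('n) \<ge> 2"
    and "n \<ge> 1" "r > 0"
  shows "prob {\<omega> \<in> space M. norm (\<Sum>i=1..n. walk X i \<omega>) \<le> r}
    \<le> exp (1/2) * (3 / (2 * c) * (r\<^sup>2 / real n ^ 3) + 2 / \<kappa>\<^sup>2 * ((real n)\<^sup>2 / r\<^sup>2))"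
proof -
  have [measurable]: "X i \<in> borel_measurable M" for i
    using indep unfolding indep_vars_def by simp
  have "\<exists>u v :: real^'n. u \<in> Basis \<and> v \<in> Basis \<and> u \<noteq> v"
  proof -
    have "\<not> card (Basis :: (real^'n) set) \<le> Suc 0" using dim by simp
    then show ?thesis by (subst (asm) card_le_Suc0_iff_eq) auto
  qed
  then obtain u v :: "real^'n" where uv: "u \<in> Basis" "v \<in> Basis" "u \<noteq> v" by blast
  have "prob {\<omega> \<in> space M. norm (\<Sum>i=1..n. walk X i \<omega>) \<le> r}
      \<le> exp (1/2) * (r\<^sup>2 / (2 * (c * real n ^ 3 / 3)) + 2 / (\<kappa> / real n * r)\<^sup>2)"
  proof (rule small_ball_of_char_decay[OF _ uv \<open>r > 0\<close>])
    show "(\<lambda>\<omega>. \<Sum>i=1..n. walk X i \<omega>) \<in> borel_measurable M"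
      unfolding walk_def by measurable
    show "cmod (char (distr M borel (\<lambda>\<omega>. w \<bullet> (\<Sum>i=1..n. walk X i \<omega>))) 1)
        \<le> exp (- (c * real n ^ 3 / 3) * (norm w)\<^sup>2)" if "norm w \<le> \<kappa> / real n" for w
      by (rule walk_sum_char_decay[OF indep ident \<open>c > 0\<close> decay \<open>n \<ge> 1\<close> that])
  qed (use \<open>c > 0\<close> \<open>\<kappa> > 0\<close> \<open>n \<ge> 1\<close> in auto)
  also have "r\<^sup>2 / (2 * (c * real n ^ 3 / 3)) = 3 / (2 * c) * (r\<^sup>2 / real n ^ 3)" by simp
  also have "2 / (\<kappa> / real n * r)\<^sup>2 = 2 / \<kappa>\<^sup>2 * ((real n)\<^sup>2 / r\<^sup>2)"
    by (simp add: power_mult_distrib power_divide)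
  finally show ?thesis .
qed

text \<open>
  With \<open>n = k ^ b\<close> the radius \<open>r\<close> chosen here makes \<open>r\<^sup>2 / n ^ 3\<close> equal to \<open>4 * k powr (- 3/2)\<close>, and
  \<open>b \<ge> 3\<close> makes \<open>n\<^sup>2 / r\<^sup>2\<close> at most of this order, so that Borel--Cantelli applies.
\<close>

lemma walk_sum_checkpoints:
  fixes X :: "nat \<Rightarrow> 'a \<Rightarrow> real^'n"
  assumes indep: "indep_vars (\<lambda>_. borel) X UNIV"
    and ident: "\<And>i. distr M borel (X i) = distr M borel (X 0)"
    and "c > 0" "\<kappa> > 0"
    and decay: "\<And>w. norm w \<le> \<kappa> \<Longrightarrow>
       cmod (char (distr M borel (\<lambda>\<omega>. w \<bullet> X 0 \<omega>)) 1) \<le> exp (- c * (norm w)\<^sup>2)"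
    and dim: "CARD('n) \<ge> 2" and b: "b \<ge> 3"
  shows "AE \<omega> in M. eventually (\<lambda>k. norm (\<Sum>i=1..k ^ b. walk X i \<omega>)
    > 2 * real k powr (3 * real b / 2 - 3/4)) sequentially"
proof -
  have [measurable]: "X i \<in> borel_measurable M" for i
    using indep unfolding indep_vars_def by simp
  define r where "r = (\<lambda>k. 2 * real k powr (3 * real b / 2 - 3/4))"
  define A where "A = (\<lambda>k. {\<omega> \<in> space M. norm (\<Sum>i=1..k ^ b. walk X i \<omega>) \<le> r k})"
  have A_sets: "A k \<in> sets M" for k
    unfolding A_def walk_def by measurable
  define C where "C = exp (1/2) * (6 / c + 1 / (2 * \<kappa>\<^sup>2))"
  have PA: "prob (A k) \<le> C * real k powr (- (3/2))" if "k \<ge> 1" for k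
  proof -
    have "r k > 0" using that by (simp add: r_def)
    have r2: "(r k)\<^sup>2 = 4 * real k powr (3 * real b - 3/2)"
      using that by (simp add: r_def power_mult_distrib powr_power algebra_simps)
    have nb: "real (k ^ b) = real k powr real b"
      using that by (simp add: powr_realpow)
    have t1: "(r k)\<^sup>2 / real (k ^ b) ^ 3 = 4 * real k powr (- (3/2))"
    proof -
      have "real (k ^ b) ^ 3 = real k powr (3 * real b)"
        unfolding nb using that by (simp add: powr_power mult.commute)
      then have "(r k)\<^sup>2 / real (k ^ b) ^ 3 = 4 * (real k powr (3 * real b - 3/2) / real k powr (3 * real b))"
        unfolding r2 by simp
      then show ?thesis unfolding powr_diff[symmetric] by simp
    qed
    have t2: "(real (k ^ b))\<^sup>2 / (r k)\<^sup>2 \<le> 1/4 * real k powr (- (3/2))"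
    proof -
      have "(real (k ^ b))\<^sup>2 = real k powr (2 * real b)"
        unfolding nb using that by (simp add: powr_power mult.commute)
      then have "(real (k ^ b))\<^sup>2 / (r k)\<^sup>2 = 1/4 * (real k powr (2 * real b) / real k powr (3 * real b - 3/2))"
        unfolding r2 by simp
      also have "\<dots> = 1/4 * real k powr (3/2 - real b)"
        unfolding powr_diff[symmetric] by (simp add: algebra_simps)
      also have "\<dots> \<le> 1/4 * real k powr (- (3/2))"
        using that b by (intro mult_left_mono powr_mono) auto
      finally show ?thesis .
    qed
    have "prob (A k) \<le> exp (1/2) * (3 / (2 * c) * ((r k)\<^sup>2 / real (k ^ b) ^ 3) + 2 / \<kappa>\<^sup>2 * ((real (k ^ b))\<^sup>2 / (r k)\<^sup>2))"
      unfolding A_def using that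
      by (intro walk_sum_small_ball[OF indep ident \<open>c > 0\<close> \<open>\<kappa> > 0\<close> decay dim _ \<open>r k > 0\<close>]) auto
    also have "\<dots> \<le> exp (1/2) * (3 / (2 * c) * (4 * real k powr (- (3/2))) + 2 / \<kappa>\<^sup>2 * (1/4 * real k powr (- (3/2))))"
      using t1 t2 \<open>c > 0\<close> by (intro mult_left_mono add_mono) auto
    also have "\<dots> = C * real k powr (- (3/2))"
      by (simp add: C_def field_simps)
    finally show ?thesis .
  qed
  have "summable (\<lambda>k. prob (A k))"
  proof (rule summable_comparison_test')
    show "summable (\<lambda>k. C * real k powr (- (3/2)))"
      by (intro summable_mult) (simp add: summable_real_powr_iff)
    show "norm (prob (A k)) \<le> C * real k powr (- (3/2))" if "k \<ge> 1" for k
      using PA[OF that] by simp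
  qed
  then have "AE \<omega> in M. eventually (\<lambda>k. \<omega> \<in> space M - A k) sequentially"
    using A_sets by (intro borel_cantelli_AE1) (auto simp: emeasure_eq_measure)
  then show ?thesis
    by (rule AE_mp) (intro AE_I2, auto simp: A_def r_def not_le elim: eventually_mono)
qed

text \<open>For each \<open>k\<close>, the \<open>k\<close>-th coordinates of independent centred steps are orthogonal.\<close>

lemma walk_growth:
  fixes X :: "nat \<Rightarrow> 'a \<Rightarrow> real^'n"
  assumes indep: "indep_vars (\<lambda>_. borel) X UNIV"
    and ident: "\<And>i. distr M borel (X i) = distr M borel (X 0)"
    and int: "integrable M (\<lambda>\<omega>. (norm (X 0 \<omega>))\<^sup>2)"
    and mean: "expectation (X 0) = 0"
    and "\<delta> > 0"
  shows "AE \<omega> in M. eventually (\<lambda>n. norm (walk X n \<omega>) \<le> real CARD('n) * real n powr (1/2 + \<delta>)) sequentially"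
proof -
  have [measurable]: "X i \<in> borel_measurable M" for i
    using indep unfolding indep_vars_def by simp
  have [measurable]: "(\<lambda>x::real^'n. x $ k) \<in> borel_measurable borel" for k
    by (subst cart_eq_inner_axis) measurable
  have coord: "AE \<omega> in M. eventually (\<lambda>n. \<bar>\<Sum>i=1..n. X i \<omega> $ k\<bar> \<le> real n powr (1/2 + \<delta>)) sequentially" for k
  proof (rule orthogonal_sums_growth[OF _ _ _ \<open>\<delta> > 0\<close>])
    let ?V = "expectation (\<lambda>\<omega>. (X 0 \<omega> $ k)\<^sup>2)"
    have transfer_int: "integrable M (\<lambda>\<omega>. f (X i \<omega>)) \<longleftrightarrow> integrable M (\<lambda>\<omega>. f (X 0 \<omega>))"
      and transfer: "expectation (\<lambda>\<omega>. f (X i \<omega>)) = expectation (\<lambda>\<omega>. f (X 0 \<omega>))"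
      if [measurable]: "f \<in> borel_measurable borel" for f :: "real^'n \<Rightarrow> real" and i
      using ident[of i] integrable_distr_eq[of "X i" M borel f] integrable_distr_eq[of "X 0" M borel f]
        integral_distr[of "X i" M borel f] integral_distr[of "X 0" M borel f] by simp_all
    have "integrable M (\<lambda>\<omega>. (X 0 \<omega> $ k)\<^sup>2)"
      by (rule Bochner_Integration.integrable_bound[OF int])
         (auto simp: abs_le_square_iff[symmetric] component_le_norm_cart)
    then have sq: "integrable M (\<lambda>\<omega>. (X i \<omega> $ k)\<^sup>2)" for i
      using transfer_int[of "\<lambda>x. (x $ k)\<^sup>2" i] by simp
    have int1: "integrable M (\<lambda>\<omega>. X i \<omega> $ k)" for i
      by (rule square_integrable_imp_integrable[OF _ sq]) measurable
    have "integrable M (X 0)"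
    proof -
      have "integrable M (\<lambda>\<omega>. norm (X 0 \<omega>))"
        by (rule square_integrable_imp_integrable[OF _ int]) measurable
      then show ?thesis by (simp add: integrable_norm_iff)
    qed
    then have "expectation (\<lambda>\<omega>. X 0 \<omega> $ k) = 0"
      using mean by (simp add: cart_eq_inner_axis)
    then have mean1: "expectation (\<lambda>\<omega>. X i \<omega> $ k) = 0" for i
      using transfer[of "\<lambda>x. x $ k" i] by simp
    have prod: "integrable M (\<lambda>\<omega>. X i \<omega> $ k * X j \<omega> $ k) \<and> expectation (\<lambda>\<omega>. X i \<omega> $ k * X j \<omega> $ k) = 0"
      if "i \<noteq> j" for i j
    proof -
      have "indep_vars (\<lambda>_. borel) (\<lambda>i \<omega>. X i \<omega> $ k) {i, j}"
        by (rule indep_vars_compose2[OF indep_vars_subset[OF indep]]) auto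
      from indep_vars_lebesgue_integral[OF _ this] indep_vars_integrable[OF _ this]
      show ?thesis using that int1 mean1 by simp
    qed
    show "integrable M (\<lambda>\<omega>. X i \<omega> $ k * X j \<omega> $ k)" for i j
      using prod[of i j] sq[of i] by (cases "i = j") (auto simp: power2_eq_square)
    show "expectation (\<lambda>\<omega>. X i \<omega> $ k * X j \<omega> $ k) = 0" if "i \<noteq> j" for i j
      using prod[OF that] by simp
    show "expectation (\<lambda>\<omega>. (X i \<omega> $ k)\<^sup>2) \<le> ?V" for i
      using transfer[of "\<lambda>x. (x $ k)\<^sup>2" i] by simp
  qed
  then have "AE \<omega> in M. \<forall>k. eventually (\<lambda>n. \<bar>\<Sum>i=1..n. X i \<omega> $ k\<bar> \<le> real n powr (1/2 + \<delta>)) sequentially"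
    by (subst AE_all_countable) auto
  then show ?thesis
  proof (rule AE_mp, intro AE_I2 impI)
    fix \<omega> assume "\<forall>k. eventually (\<lambda>n. \<bar>\<Sum>i=1..n. X i \<omega> $ k\<bar> \<le> real n powr (1/2 + \<delta>)) sequentially"
    then have "eventually (\<lambda>n. \<forall>k. \<bar>\<Sum>i=1..n. X i \<omega> $ k\<bar> \<le> real n powr (1/2 + \<delta>)) sequentially"
      by (simp add: eventually_all_finite)
    then show "eventually (\<lambda>n. norm (walk X n \<omega>) \<le> real CARD('n) * real n powr (1/2 + \<delta>)) sequentially"
    proof eventually_elim
      case (elim n)
      have "norm (walk X n \<omega>) \<le> (\<Sum>k\<in>UNIV. \<bar>walk X n \<omega> $ k\<bar>)"
        by (rule norm_le_l1_cart)
      also have "\<dots> \<le> (\<Sum>k\<in>(UNIV::'n set). real n powr (1/2 + \<delta>))"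
        using elim by (intro sum_mono) (simp add: walk_def)
      finally show ?case by simp
    qed
  qed
qed

end

section \<open>The logarithmic growth rate of the centre of mass\<close>

theorem theorem1p8:
  fixes M :: "'a measure"
    and X :: "nat \<Rightarrow> 'a \<Rightarrow> real^'n"
    and H :: "real^'n^'n"
  assumes "prob_space M"
    and "CARD('n) \<ge> 2"
    and "prob_space.indep_vars M (\<lambda>_. borel) X UNIV"
    and "\<And>i. distr M borel (X i) = distr M borel (X 0)"
    and "integrable M (\<lambda>\<omega>. (norm (X 0 \<omega>))\<^sup>2)"
    and "(\<integral>\<omega>. X 0 \<omega> \<partial>M) = 0"
    and "positive_definite (second_moment_matrix M (X 0))"
    and "is_minimal_subgroup M (X 0) (lattice_gen H)"
    and "\<bar>det H\<bar> > 0"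
  shows "AE \<omega> in M.
    (\<lambda>n. elog (norm (center_of_mass X n \<omega>)) / ereal (ln (real n))) \<longlonglongrightarrow> ereal (1/2)"
proof -
  interpret prob_space M by (rule assms(1))
  note indep = assms(3) and ident = assms(4) and int = assms(5) and mean = assms(6)
  have X0: "X 0 \<in> borel_measurable M"
    using indep unfolding indep_vars_def by simp
  obtain l where l: "l > 0" "\<And>w. l * (norm w)\<^sup>2 \<le> w \<bullet> (second_moment_matrix M (X 0) *v w)"
    using positive_definite_lower_bound[OF assms(7)] by blast
  have nondeg: "l * (norm w)\<^sup>2 \<le> expectation (\<lambda>\<omega>. (w \<bullet> X 0 \<omega>)\<^sup>2)" for w
    using l(2)[of w] unfolding inner_second_moment_matrix[OF X0 int] .
  obtain c \<kappa> where c: "c > 0" "\<kappa> > 0"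
    "\<And>w. norm w \<le> \<kappa> \<Longrightarrow>
       cmod (char (distr M borel (\<lambda>\<omega>. w \<bullet> X 0 \<omega>)) 1) \<le> exp (- c * (norm w)\<^sup>2)"
    using char_gaussian_decay[OF X0 int mean l(1) nondeg] by blast
  let ?T = "\<lambda>n \<omega>. \<Sum>i=1..n. walk X i \<omega>"
  let ?\<delta> = "\<lambda>b. 1 / (8 * real b)"
  have "AE \<omega> in M. \<forall>b\<in>{3..}.
      eventually (\<lambda>k. norm (?T (k ^ b) \<omega>) > 2 * real k powr (3 * real b / 2 - 3/4)) sequentially"
    using walk_sum_checkpoints[OF indep ident c assms(2)] by (subst AE_ball_countable) auto
  moreover have "AE \<omega> in M. \<forall>b\<in>{3..}.
      eventually (\<lambda>n. norm (walk X n \<omega>) \<le> real CARD('n) * real n powr (1/2 + ?\<delta> b)) sequentially"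
    using walk_growth[OF indep ident int mean] by (subst AE_ball_countable) auto
  ultimately show ?thesis
  proof eventually_elim
    case (elim \<omega>)
    have checkpoints: "eventually (\<lambda>k. norm (?T (k ^ b) \<omega>) > 2 * real k powr (3 * real b / 2 - 3/4)) sequentially"
      and growth: "eventually (\<lambda>n. norm (walk X n \<omega>) \<le> real CARD('n) * real n powr (1/2 + ?\<delta> b)) sequentially"
      if "b \<ge> 3" for b using elim that by auto
    show "(\<lambda>n. elog (norm (center_of_mass X n \<omega>)) / ereal (ln (real n))) \<longlonglongrightarrow> ereal (1/2)"
    proof (rule elog_ratio_tendsto)
      fix \<eta> :: real assume "\<eta> > 0"
      obtain b :: nat where b: "b \<ge> 3" "1 / real b < \<eta>"
      proof
        define b where "b = max 3 (Suc (nat \<lceil>1 / \<eta>\<rceil>))"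
        show "b \<ge> 3" by (simp add: b_def)
        have "1 / \<eta> < real b" unfolding b_def by linarith
        with \<open>\<eta> > 0\<close> \<open>b \<ge> 3\<close> show "1 / real b < \<eta>" by (simp add: field_simps)
      qed
      have "?\<delta> b < \<eta>" "0 < ?\<delta> b"
        using b by (auto intro: order.strict_trans1[rotated] simp: field_simps)
      have lower: "eventually (\<lambda>n. norm (?T n \<omega>) \<ge> real n powr (3/2 - 1 / real b)) sequentially"
        using b growth[OF b(1)] checkpoints[OF b(1)]
        by (intro partial_sums_lower_growth[of b "real CARD('n)"]) auto
      have upper: "eventually (\<lambda>n. norm (?T n \<omega>) \<le> real n powr (1 + 1/2 + \<eta>)) sequentially"
        by (rule partial_sums_upper_growth[OF _ \<open>0 < ?\<delta> b\<close> \<open>?\<delta> b < \<eta>\<close> _ growth[OF b(1)]]) auto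
      show "eventually (\<lambda>n. real n powr (1/2 - \<eta>) \<le> norm (center_of_mass X n \<omega>)
          \<and> norm (center_of_mass X n \<omega>) \<le> real n powr (1/2 + \<eta>)) sequentially"
        using lower upper eventually_ge_at_top[of 1]
      proof eventually_elim
        case (elim n)
        have G: "norm (center_of_mass X n \<omega>) = norm (?T n \<omega>) / real n"
          by (simp add: center_of_mass_def)
        have "real n powr (1/2 - \<eta>) \<le> real n powr (3/2 - 1 / real b - 1)"
          using elim b by (intro powr_mono) auto
        also have "\<dots> = real n powr (3/2 - 1 / real b) / real n"
          by (subst powr_diff) (use elim in simp)
        also have "\<dots> \<le> norm (?T n \<omega>) / real n"
          using elim by (intro divide_right_mono) auto
        finally have 1: "real n powr (1/2 - \<eta>) \<le> norm (?T n \<omega>) / real n" .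
        have "norm (?T n \<omega>) / real n \<le> real n powr (1 + 1/2 + \<eta>) / real n"
          using elim by (intro divide_right_mono) auto
        also have "1 + 1/2 + \<eta> = 1 + (1/2 + \<eta>)" by simp
        also have "real n powr (1 + (1/2 + \<eta>)) / real n = real n powr (1/2 + \<eta>)"
          unfolding powr_add[of _ 1] using elim by simp
        finally show ?case using 1 unfolding G by blast
      qed
    qed
  qed
qed

end
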